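(* Let $A$ be a nondeterministic Büchi automaton over $2^{I\cup O}$ with states $S = \{s_0,\dots,s_{k-1}\}$, initial state $s_0$, every state and transition lying on an accepting run, and let $X \subseteq O$ be automata dependent on $I \cup (O\setminus X)$ in $A$. Consider the sequential circuit with state bits $p_0,\dots,p_{k-1}$, inputs $I \cup (O\setminus X)$, next-state function $\Delta^X$ with $n_i = \bigvee_{s_j \in in(s_i)} \big(p_j \wedge \exists X\, B_{(s_j,s_i)}\big)$ for $i = 0,\dots,k-1$, and output function $\Lambda^X$ whose output for $x_i \in X$ is $\bigvee_{(s,s')} \big(p_s \wedge B_{(s,s')}[X \mapsto F^{(s,s')}] \wedge F^{(s,s')}_i\big)$ over all transitions $(s,s')$, where $F^{(s,s')}$ are as described below. Assume (a) the initial state is $p_0 = 1$ and $p_j = 0$ for $j = 1,\dots,k-1$, and (b) the output is interpreted as $\bot$ whenever $\bigvee_{i=0}^{k-1} n_i$ evaluates to $0$. Then this circuit is a correct implementation of the transducer $T_X$: on every sequence of input letters from $\Sigma_I \times \Sigma_{O\setminus X}$ it produces the same sequence of outputs as $T_X$.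
   Context: $\Sigma_Z = 2^Z$; letters are triples $(\sigma_I,\sigma,\sigma') \in \Sigma_I\times\Sigma_{O\setminus X}\times\Sigma_X$. $B_{(s,s')}$ is the Boolean function over $I \cup O$ whose satisfying assignments are the letters $a$ with $s' \in \delta(s,a)$; $in(s_i)$ is the set of states with a transition to $s_i$; $p_s = p_j$ for $s = s_j$. At each step the circuit reads an input letter, produces outputs from the current $p$ and the input, and updates $p_i := n_i$. For each transition $(s,s')$, $F^{(s,s')} = \langle F^{(s,s')}_1,\dots,F^{(s,s')}_{|X|}\rangle$ are Boolean functions over $I\cup(O\setminus X)$ such that for every assignment to $I \cup (O\setminus X)$, $\exists X\, B_{(s,s')}$ implies $B_{(s,s')}[X \mapsto F^{(s,s')}]$. The transducer $T_X$ has state set $2^S$, initial state $\{s_0\}$, transition $\delta^X(U,(\sigma_I,\sigma)) = \{q' \mid \exists q \in U\ \exists\sigma' \in \Sigma_X : q' \in \delta(q,(\sigma_I,\sigma,\sigma'))\}$, and output $\lambda^X(U,(\sigma_I,\sigma))$ equal to the unique $\sigma_X$ with $\delta^X(U,(\sigma_I,\sigma)) = \{q' \mid \exists q\in U: q' \in \delta(q,(\sigma_I,\sigma,\sigma_X))\}$ if $\delta^X(U,(\sigma_I,\sigma)) \ne \emptyset$, and $\bot$ otherwise. A pair of states is compatible if some finite word has runs from $s_0$ to both. $X$ is automata dependent on $Y$ if for every compatible pair $(s,s')$ and letters $a,a'$ agreeing on $Y$ but not on $X$, not both $\delta(s,a)$ and $\delta(s',a')$ are nonempty. *)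

theory Defs
  imports "HOL-Library.Omega_Words_Fun"
begin

text \<open>
  A letter of the alphabet \<open>2\<^sup>Z\<close> is the set of variables it makes true, so the alphabet is
  \<^term>\<open>Pow Z\<close>. For pairwise disjoint variable sets, the tuple of letters
  \<open>(\<sigma>\<^sub>I, \<sigma>, \<sigma>')\<close> is identified with the letter \<open>\<sigma>\<^sub>I \<union> \<sigma> \<union> \<sigma>'\<close>.
\<close>

record ('q, 'v) nba =
  states :: "'q set"
  init :: 'q
  delta :: "'q \<Rightarrow> 'v set \<Rightarrow> 'q set"
  accepting :: "'q set"

definition nba_over :: "'v set \<Rightarrow> ('q, 'v) nba \<Rightarrow> bool" where
  "nba_over Z A \<longleftrightarrow>
     finite (states A) \<and> init A \<in> states A \<and> accepting A \<subseteq> states A \<and>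
     (\<forall>q \<in> states A. \<forall>a \<in> Pow Z. delta A q a \<subseteq> states A)"

definition accepting_run :: "'v set \<Rightarrow> ('q, 'v) nba \<Rightarrow> 'v set word \<Rightarrow> 'q word \<Rightarrow> bool" where
  "accepting_run Z A w r \<longleftrightarrow>
     (\<forall>n. w n \<in> Pow Z) \<and> r 0 = init A \<and> (\<forall>n. r (Suc n) \<in> delta A (r n) (w n)) \<and>
     limit r \<inter> accepting A \<noteq> {}"

definition trim :: "'v set \<Rightarrow> ('q, 'v) nba \<Rightarrow> bool" where
  "trim Z A \<longleftrightarrow>
     (\<forall>q \<in> states A. \<exists>w r n. accepting_run Z A w r \<and> r n = q) \<and>
     (\<forall>q \<in> states A. \<forall>a \<in> Pow Z. \<forall>q' \<in> delta A q a.
        \<exists>w r n. accepting_run Z A w r \<and> r n = q \<and> w n = a \<and> r (Suc n) = q')"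

fun finite_run :: "('q, 'v) nba \<Rightarrow> 'q \<Rightarrow> 'v set list \<Rightarrow> 'q \<Rightarrow> bool" where
  "finite_run A q [] q' \<longleftrightarrow> q = q'"
| "finite_run A q (a # u) q' \<longleftrightarrow> (\<exists>q'' \<in> delta A q a. finite_run A q'' u q')"

definition compatible :: "'v set \<Rightarrow> ('q, 'v) nba \<Rightarrow> 'q \<Rightarrow> 'q \<Rightarrow> bool" where
  "compatible Z A s s' \<longleftrightarrow>
     (\<exists>u \<in> lists (Pow Z). finite_run A (init A) u s \<and> finite_run A (init A) u s')"

definition automata_dependent ::
    "'v set \<Rightarrow> ('q, 'v) nba \<Rightarrow> 'v set \<Rightarrow> 'v set \<Rightarrow> bool" where
  "automata_dependent Z A X Y \<longleftrightarrow>
     (\<forall>s \<in> states A. \<forall>s' \<in> states A. compatible Z A s s' \<longrightarrow>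
        (\<forall>a \<in> Pow Z. \<forall>a' \<in> Pow Z. a \<inter> Y = a' \<inter> Y \<and> a \<inter> X \<noteq> a' \<inter> X \<longrightarrow>
           \<not> (delta A s a \<noteq> {} \<and> delta A s' a' \<noteq> {})))"

text \<open>
  Boolean functions are predicates on assignments, an assignment being the set of variables
  mapped to true.
\<close>

type_synonym 'v boolfun = "'v set \<Rightarrow> bool"

definition boolfun_over :: "'v set \<Rightarrow> 'v boolfun \<Rightarrow> bool" where
  "boolfun_over V f \<longleftrightarrow> (\<forall>\<sigma>. f \<sigma> = f (\<sigma> \<inter> V))"

definition ex_quant :: "'v set \<Rightarrow> 'v boolfun \<Rightarrow> 'v boolfun" where
  "ex_quant X f \<sigma> \<longleftrightarrow> (\<exists>\<sigma>' \<in> Pow X. f ((\<sigma> - X) \<union> \<sigma>'))"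

definition bf_subst :: "'v set \<Rightarrow> ('v \<Rightarrow> 'v boolfun) \<Rightarrow> 'v boolfun \<Rightarrow> 'v boolfun" where
  "bf_subst X G f \<sigma> \<longleftrightarrow> f ((\<sigma> - X) \<union> {x \<in> X. G x \<sigma>})"

definition transitions :: "'v set \<Rightarrow> ('q, 'v) nba \<Rightarrow> ('q \<times> 'q) set" where
  "transitions Z A = {(q, q'). q \<in> states A \<and> (\<exists>a \<in> Pow Z. q' \<in> delta A q a)}"

definition in_states :: "'v set \<Rightarrow> ('q, 'v) nba \<Rightarrow> 'q \<Rightarrow> 'q set" where
  "in_states Z A q' = {q. (q, q') \<in> transitions Z A}"

definition B_fun :: "'v set \<Rightarrow> ('q, 'v) nba \<Rightarrow> 'q \<Rightarrow> 'q \<Rightarrow> 'v boolfun" where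
  "B_fun Z A q q' \<sigma> \<longleftrightarrow> q' \<in> delta A q (\<sigma> \<inter> Z)"

text \<open>
  The tuple \<open>F\<^bsup>(q, q')\<^esup>\<close> is indexed by the variables in \<open>X\<close> rather than by \<open>1, \<dots>, |X|\<close>.
\<close>

definition skolem_functions ::
    "'v set \<Rightarrow> 'v set \<Rightarrow> ('q, 'v) nba \<Rightarrow> 'v set \<Rightarrow> ('q \<Rightarrow> 'q \<Rightarrow> 'v \<Rightarrow> 'v boolfun) \<Rightarrow> bool" where
  "skolem_functions I Out A X F \<longleftrightarrow>
     (\<forall>(q, q') \<in> transitions (I \<union> Out) A.
        (\<forall>x \<in> X. boolfun_over (I \<union> (Out - X)) (F q q' x)) \<and>
        (\<forall>\<sigma> \<in> Pow (I \<union> (Out - X)).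
           ex_quant X (B_fun (I \<union> Out) A q q') \<sigma> \<longrightarrow>
           bf_subst X (F q q') (B_fun (I \<union> Out) A q q') \<sigma>))"

text \<open>
  In a sequential circuit, \<open>next_bit i p \<sigma>\<close> and \<open>out_bit x p \<sigma>\<close> are the values of \<open>n\<^sub>i\<close> and of the
  output \<open>x\<close> for the values \<open>p\<close> of the state bits and the assignment \<open>\<sigma>\<close> to the inputs.
  Only the state bits below \<open>num_bits\<close> are meaningful.
\<close>

record 'v seq_circuit =
  num_bits :: nat
  outputs :: "'v set"
  next_bit :: "nat \<Rightarrow> (nat \<Rightarrow> bool) \<Rightarrow> 'v boolfun"
  out_bit :: "'v \<Rightarrow> (nat \<Rightarrow> bool) \<Rightarrow> 'v boolfun"

primrec circuit_state ::
    "'v seq_circuit \<Rightarrow> (nat \<Rightarrow> bool) \<Rightarrow> 'v set word \<Rightarrow> nat \<Rightarrow> (nat \<Rightarrow> bool)" where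
  "circuit_state C p w 0 = p"
| "circuit_state C p w (Suc n) = (\<lambda>i. next_bit C i (circuit_state C p w n) (w n))"

text \<open>
  The output letter is read as \<open>\<bottom>\<close>, rendered as \<^term>\<open>None\<close>, when all next-state bits are 0.
\<close>

definition circuit_output ::
    "'v seq_circuit \<Rightarrow> (nat \<Rightarrow> bool) \<Rightarrow> 'v set word \<Rightarrow> 'v set option word" where
  "circuit_output C p w n =
     (if \<exists>i < num_bits C. next_bit C i (circuit_state C p w n) (w n)
      then Some {x \<in> outputs C. out_bit C x (circuit_state C p w n) (w n)}
      else None)"

definition dependent_circuit ::
    "'v set \<Rightarrow> 'v set \<Rightarrow> ('q, 'v) nba \<Rightarrow> 'v set \<Rightarrow> nat \<Rightarrow> (nat \<Rightarrow> 'q) \<Rightarrow>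
     ('q \<Rightarrow> 'q \<Rightarrow> 'v \<Rightarrow> 'v boolfun) \<Rightarrow> 'v seq_circuit" where
  "dependent_circuit I Out A X k s F =
     \<lparr> num_bits = k,
       outputs = X,
       next_bit = (\<lambda>i p \<sigma>.
         \<exists>j < k. s j \<in> in_states (I \<union> Out) A (s i) \<and>
           p j \<and> ex_quant X (B_fun (I \<union> Out) A (s j) (s i)) \<sigma>),
       out_bit = (\<lambda>x p \<sigma>.
         \<exists>j < k. \<exists>i < k. (s j, s i) \<in> transitions (I \<union> Out) A \<and>
           p j \<and> bf_subst X (F (s j) (s i)) (B_fun (I \<union> Out) A (s j) (s i)) \<sigma> \<and>
           F (s j) (s i) x \<sigma>) \<rparr>"

record ('s, 'i, 'o) transducer =
  t_states :: "'s set"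
  t_init :: 's
  t_delta :: "'s \<Rightarrow> 'i \<Rightarrow> 's"
  t_lambda :: "'s \<Rightarrow> 'i \<Rightarrow> 'o"

primrec transducer_state :: "('s, 'i, 'o) transducer \<Rightarrow> 'i word \<Rightarrow> 's word" where
  "transducer_state T w 0 = t_init T"
| "transducer_state T w (Suc n) = t_delta T (transducer_state T w n) (w n)"

definition transducer_output :: "('s, 'i, 'o) transducer \<Rightarrow> 'i word \<Rightarrow> 'o word" where
  "transducer_output T w n = t_lambda T (transducer_state T w n) (w n)"

definition delta_X ::
    "('q, 'v) nba \<Rightarrow> 'v set \<Rightarrow> 'q set \<Rightarrow> 'v set \<times> 'v set \<Rightarrow> 'q set" where
  "delta_X A X U = (\<lambda>(\<sigma>\<^sub>I, \<sigma>).
     {q'. \<exists>q \<in> U. \<exists>\<sigma>' \<in> Pow X. q' \<in> delta A q (\<sigma>\<^sub>I \<union> \<sigma> \<union> \<sigma>')})"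

definition lambda_X ::
    "('q, 'v) nba \<Rightarrow> 'v set \<Rightarrow> 'q set \<Rightarrow> 'v set \<times> 'v set \<Rightarrow> 'v set option" where
  "lambda_X A X U = (\<lambda>(\<sigma>\<^sub>I, \<sigma>).
     if delta_X A X U (\<sigma>\<^sub>I, \<sigma>) \<noteq> {}
     then Some (THE \<sigma>\<^sub>X. \<sigma>\<^sub>X \<in> Pow X \<and>
       delta_X A X U (\<sigma>\<^sub>I, \<sigma>) = {q'. \<exists>q \<in> U. q' \<in> delta A q (\<sigma>\<^sub>I \<union> \<sigma> \<union> \<sigma>\<^sub>X)})
     else None)"

definition T\<^sub>X ::
    "('q, 'v) nba \<Rightarrow> 'v set \<Rightarrow> ('q set, 'v set \<times> 'v set, 'v set option) transducer" where
  "T\<^sub>X A X =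
     \<lparr> t_states = Pow (states A),
       t_init = {init A},
       t_delta = delta_X A X,
       t_lambda = lambda_X A X \<rparr>"

end

theory Submission
  imports Defs
begin

text \<open>
  All states of the subset reached by the transducer are reached by runs on one common word, hence
  are pairwise compatible. Dependence then forces all transitions that are enabled in the subset by
  the given input to carry the same letter over \<open>X\<close>. This letter is the output of the transducer, and
  every transition that is active in the circuit has its Skolem functions evaluate to it.
\<close>

text \<open>This is the invariant along the transducer's run. A single word serves all states of
  \<open>U\<close> at once, so pairwise compatibility is immediate and a step extends only that
  word. The empty set qualifies, so the invariant survives when the automaton dies.\<close>

definition jointly_reachable :: "'v set \<Rightarrow> ('q, 'v) nba \<Rightarrow> 'q set \<Rightarrow> bool" where
  "jointly_reachable Z A U \<longleftrightarrow>
     U \<subseteq> states A \<and> (\<exists>u \<in> lists (Pow Z). \<forall>q \<in> U. finite_run A (init A) u q)"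

text \<open>\<open>finite_run\<close> recurses at the front of the word, whereas the subset
  construction extends it at the end.\<close>

lemma finite_run_snoc:
  "finite_run A q (u @ [a]) q' \<longleftrightarrow> (\<exists>q''. finite_run A q u q'' \<and> q' \<in> delta A q'' a)"
  by (induction u arbitrary: q) auto

text \<open>Here dependence enters. Both letters share the part \<open>c\<close> outside
  \<open>X\<close>, and the two states are compatible, so distinct parts over \<open>X\<close> would
  leave one of the two successor sets empty. The case \<open>q1 = q2\<close> is included.\<close>

lemma dependent_letter_unique:
  assumes dep: "automata_dependent Z A X (Z - X)" and "X \<subseteq> Z"
    and reach: "jointly_reachable Z A U" and "q1 \<in> U" "q2 \<in> U"
    and "c \<subseteq> Z - X" "\<tau>1 \<subseteq> X" "\<tau>2 \<subseteq> X"
    and "delta A q1 (c \<union> \<tau>1) \<noteq> {}" "delta A q2 (c \<union> \<tau>2) \<noteq> {}"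
  shows "\<tau>1 = \<tau>2"
proof (rule ccontr)
  assume "\<tau>1 \<noteq> \<tau>2"
  have states: "q1 \<in> states A" "q2 \<in> states A" and compat: "compatible Z A q1 q2"
    using reach \<open>q1 \<in> U\<close> \<open>q2 \<in> U\<close> unfolding jointly_reachable_def compatible_def by blast+
  have letters: "c \<union> \<tau>1 \<in> Pow Z" "c \<union> \<tau>2 \<in> Pow Z"
    using assms(2,6-8) by blast+
  have "(c \<union> \<tau>1) \<inter> X = \<tau>1" "(c \<union> \<tau>2) \<inter> X = \<tau>2"
    using assms(6-8) by blast+
  then have "(c \<union> \<tau>1) \<inter> (Z - X) = (c \<union> \<tau>2) \<inter> (Z - X) \<and> (c \<union> \<tau>1) \<inter> X \<noteq> (c \<union> \<tau>2) \<inter> X"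
    using assms(6-8) \<open>\<tau>1 \<noteq> \<tau>2\<close> by auto
  then show False
    using dep[unfolded automata_dependent_def, rule_format, OF states compat letters] assms(9,10)
    by simp
qed

text \<open>One enabled choice of \<open>\<tau>\<close> at one state of \<open>U\<close> fixes the
  choice at every other state, so the existential over \<open>X\<close> in \<open>delta_X\<close>
  collapses to this \<open>\<tau>\<close>.\<close>

lemma delta_X_eq:
  assumes "automata_dependent Z A X (Z - X)" and "X \<subseteq> Z" and "jointly_reachable Z A U"
    and "q \<in> U" and "\<sigma>I \<union> \<sigma> \<subseteq> Z - X" and "\<tau> \<subseteq> X" and "delta A q (\<sigma>I \<union> \<sigma> \<union> \<tau>) \<noteq> {}"
  shows "delta_X A X U (\<sigma>I, \<sigma>) = {q'. \<exists>q \<in> U. q' \<in> delta A q (\<sigma>I \<union> \<sigma> \<union> \<tau>)}"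
proof -
  have "\<tau>' = \<tau>" if "r \<in> U" "\<tau>' \<subseteq> X" "q' \<in> delta A r (\<sigma>I \<union> \<sigma> \<union> \<tau>')" for r \<tau>' q'
  proof (rule dependent_letter_unique[OF assms(1-3) that(1) \<open>q \<in> U\<close> assms(5)])
    show "delta A r (\<sigma>I \<union> \<sigma> \<union> \<tau>') \<noteq> {}"
      using that by blast
  qed (use assms that in simp_all)
  then show ?thesis
    unfolding delta_X_def using \<open>\<tau> \<subseteq> X\<close> by auto
qed

text \<open>The definite description is well defined because the successor set is nonempty: any
  candidate \<open>\<sigma>X\<close> must also produce \<open>q'\<close>, hence is enabled at some
  state of \<open>U\<close>, hence equals \<open>\<tau>\<close>.\<close>

lemma lambda_X_eq:
  assumes "automata_dependent Z A X (Z - X)" and "X \<subseteq> Z" and "jointly_reachable Z A U"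
    and "q \<in> U" and "\<sigma>I \<union> \<sigma> \<subseteq> Z - X" and "\<tau> \<subseteq> X" and "q' \<in> delta A q (\<sigma>I \<union> \<sigma> \<union> \<tau>)"
  shows "lambda_X A X U (\<sigma>I, \<sigma>) = Some \<tau>"
proof -
  have eq: "delta_X A X U (\<sigma>I, \<sigma>) = {q'. \<exists>q \<in> U. q' \<in> delta A q (\<sigma>I \<union> \<sigma> \<union> \<tau>)}"
    using delta_X_eq[OF assms(1-6)] assms(7) by blast
  then have q': "q' \<in> delta_X A X U (\<sigma>I, \<sigma>)"
    using assms by blast
  have "(THE \<sigma>X. \<sigma>X \<in> Pow X \<and>
      delta_X A X U (\<sigma>I, \<sigma>) = {q'. \<exists>q \<in> U. q' \<in> delta A q (\<sigma>I \<union> \<sigma> \<union> \<sigma>X)}) = \<tau>"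
  proof (rule the_equality)
    fix \<sigma>X
    assume \<sigma>X: "\<sigma>X \<in> Pow X \<and>
      delta_X A X U (\<sigma>I, \<sigma>) = {q'. \<exists>q \<in> U. q' \<in> delta A q (\<sigma>I \<union> \<sigma> \<union> \<sigma>X)}"
    then obtain r where "r \<in> U" "q' \<in> delta A r (\<sigma>I \<union> \<sigma> \<union> \<sigma>X)"
      using q' by blast
    then show "\<sigma>X = \<tau>"
      using dependent_letter_unique[OF assms(1-3) _ \<open>q \<in> U\<close> assms(5) _ \<open>\<tau> \<subseteq> X\<close>, of r \<sigma>X]
        assms(7) \<sigma>X by blast
  qed (use eq \<open>\<tau> \<subseteq> X\<close> in blast)
  then show ?thesis
    using q' unfolding lambda_X_def by auto
qed

text \<open>All successors are reached by the same letter, so appending it to the common word for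
  \<open>U\<close> gives a common word for them.\<close>

lemma jointly_reachable_delta_X:
  assumes "nba_over Z A" and "automata_dependent Z A X (Z - X)" and "X \<subseteq> Z"
    and reach: "jointly_reachable Z A U" and "\<sigma>I \<union> \<sigma> \<subseteq> Z - X"
  shows "jointly_reachable Z A (delta_X A X U (\<sigma>I, \<sigma>))"
proof (cases "delta_X A X U (\<sigma>I, \<sigma>) = {}")
  case True
  then show ?thesis
    unfolding jointly_reachable_def by (auto intro: bexI[of _ "[]"])
next
  case False
  then obtain q \<tau> where \<tau>: "q \<in> U" "\<tau> \<subseteq> X" "delta A q (\<sigma>I \<union> \<sigma> \<union> \<tau>) \<noteq> {}"
    unfolding delta_X_def by auto
  have eq: "delta_X A X U (\<sigma>I, \<sigma>) = {q'. \<exists>q \<in> U. q' \<in> delta A q (\<sigma>I \<union> \<sigma> \<union> \<tau>)}"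
    using delta_X_eq[OF assms(2,3) reach \<tau>(1) assms(5) \<tau>(2,3)] .
  obtain u where u: "u \<in> lists (Pow Z)" "\<forall>q \<in> U. finite_run A (init A) u q"
    using reach unfolding jointly_reachable_def by blast
  have letter: "\<sigma>I \<union> \<sigma> \<union> \<tau> \<in> Pow Z"
    using assms \<tau> by blast
  have "delta A r (\<sigma>I \<union> \<sigma> \<union> \<tau>) \<subseteq> states A" if "r \<in> U" for r
  proof -
    have "r \<in> states A"
      using reach that unfolding jointly_reachable_def by blast
    with assms(1) letter show ?thesis
      unfolding nba_over_def by simp
  qed
  then have "delta_X A X U (\<sigma>I, \<sigma>) \<subseteq> states A"
    unfolding eq by blast
  moreover have "u @ [\<sigma>I \<union> \<sigma> \<union> \<tau>] \<in> lists (Pow Z)"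
    using u letter by simp
  moreover have "\<forall>q' \<in> delta_X A X U (\<sigma>I, \<sigma>). finite_run A (init A) (u @ [\<sigma>I \<union> \<sigma> \<union> \<tau>]) q'"
    using u(2) unfolding eq finite_run_snoc by blast
  ultimately show ?thesis
    unfolding jointly_reachable_def by blast
qed

text \<open>On an assignment inside \<open>Z - X\<close>, removing \<open>X\<close> and intersecting
  with \<open>Z\<close> change nothing, so the circuit's Boolean functions become plain statements
  about \<open>delta\<close>. The next lemma does the same for substitution.\<close>

lemma ex_quant_B_fun:
  assumes "c \<subseteq> Z - X" and "X \<subseteq> Z"
  shows "ex_quant X (B_fun Z A q q') c \<longleftrightarrow> (\<exists>\<tau> \<in> Pow X. q' \<in> delta A q (c \<union> \<tau>))"
proof -
  have "(c - X \<union> \<tau>) \<inter> Z = c \<union> \<tau>" if "\<tau> \<in> Pow X" for \<tau>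
    using assms that by blast
  then show ?thesis
    unfolding ex_quant_def B_fun_def by simp
qed

lemma bf_subst_B_fun:
  assumes "c \<subseteq> Z - X" and "X \<subseteq> Z"
  shows "bf_subst X G (B_fun Z A q q') c \<longleftrightarrow> q' \<in> delta A q (c \<union> {x \<in> X. G x c})"
proof -
  have "(c - X \<union> {x \<in> X. G x c}) \<inter> Z = c \<union> {x \<in> X. G x c}"
    using assms by blast
  then show ?thesis
    unfolding bf_subst_def B_fun_def by simp
qed

text \<open>The abstraction map from circuit states to transducer states. It discards the bits from
  \<open>k\<close> on, which \<open>circuit_state\<close> updates as well.\<close>

definition subset_of_bits :: "nat \<Rightarrow> (nat \<Rightarrow> 'q) \<Rightarrow> (nat \<Rightarrow> bool) \<Rightarrow> 'q set" where
  "subset_of_bits k s p = {s j |j. j < k \<and> p j}"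

lemma subset_of_bits_initial:
  assumes "0 < k" and "p 0" and "\<forall>j \<in> {1..<k}. \<not> p j"
  shows "subset_of_bits k s p = {s 0}"
proof -
  have "j < k \<and> p j \<longleftrightarrow> j = 0" for j
    using assms by (cases j) auto
  then show ?thesis
    unfolding subset_of_bits_def by simp
qed

text \<open>The abstraction map commutes with one step. The guard \<open>in_states\<close> excludes
  nothing, as an enabled move from a state is a transition, and surjectivity of \<open>s\<close>
  supplies an index for each successor.\<close>

lemma subset_of_bits_next:
  assumes "nba_over (I \<union> Out) A" and s: "s ` {..<k} = states A"
    and "X \<subseteq> Out" and c: "\<sigma>I \<union> \<sigma> \<subseteq> I \<union> Out - X"
  shows "subset_of_bits k s
      (\<lambda>i. next_bit (dependent_circuit I Out A X k s F) i p (\<sigma>I \<union> \<sigma>)) =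
    delta_X A X (subset_of_bits k s p) (\<sigma>I, \<sigma>)" (is "?L = ?R")
proof (intro equalityI subsetI)
  have X: "X \<subseteq> I \<union> Out"
    using \<open>X \<subseteq> Out\<close> by blast
  let ?next = "next_bit (dependent_circuit I Out A X k s F)"
  have bit: "?next i p (\<sigma>I \<union> \<sigma>) \<longleftrightarrow>
      (\<exists>j < k. s j \<in> in_states (I \<union> Out) A (s i) \<and> p j \<and>
        (\<exists>\<tau> \<in> Pow X. s i \<in> delta A (s j) (\<sigma>I \<union> \<sigma> \<union> \<tau>)))" for i
    by (simp add: dependent_circuit_def ex_quant_B_fun[OF c X])
  {
    fix q'
    assume "q' \<in> ?L"
    then obtain i j \<tau> where "q' = s i" "j < k" "p j" "\<tau> \<in> Pow X"
        "s i \<in> delta A (s j) (\<sigma>I \<union> \<sigma> \<union> \<tau>)"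
      unfolding subset_of_bits_def bit by blast
    then show "q' \<in> ?R"
      unfolding subset_of_bits_def delta_X_def by auto
  next
    fix q'
    assume "q' \<in> ?R"
    then obtain j \<tau> where j: "j < k" "p j" "\<tau> \<in> Pow X" "q' \<in> delta A (s j) (\<sigma>I \<union> \<sigma> \<union> \<tau>)"
      unfolding subset_of_bits_def delta_X_def by auto
    have letter: "\<sigma>I \<union> \<sigma> \<union> \<tau> \<in> Pow (I \<union> Out)"
      using c X j by blast
    have "s j \<in> states A"
      using s j(1) by blast
    then have in_q': "s j \<in> in_states (I \<union> Out) A q'" and "q' \<in> states A"
      using assms(1) j letter unfolding nba_over_def in_states_def transitions_def by blast+
    then obtain i where "i < k" "q' = s i"
      using s by blast
    then show "q' \<in> ?L"
      using j in_q' unfolding subset_of_bits_def bit by blast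
  }
qed

text \<open>An output bit is a disjunction over all active transitions and could mix their Skolem
  values. It does not, since every active transition has value \<open>\<tau>\<close>, and at least
  one is active.\<close>

lemma dependent_circuit_output_letter:
  assumes "nba_over (I \<union> Out) A" and s: "s ` {..<k} = states A"
    and "X \<subseteq> Out" and c: "c \<subseteq> I \<union> Out - X"
    and dep: "automata_dependent (I \<union> Out) A X (I \<union> Out - X)"
    and skolem: "skolem_functions I Out A X F"
    and reach: "jointly_reachable (I \<union> Out) A (subset_of_bits k s p)"
    and "q \<in> subset_of_bits k s p" and "\<tau> \<subseteq> X" and "q' \<in> delta A q (c \<union> \<tau>)"
  shows "{x \<in> X. out_bit (dependent_circuit I Out A X k s F) x p c} = \<tau>"
proof -
  have X: "X \<subseteq> I \<union> Out"
    using \<open>X \<subseteq> Out\<close> by blast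
  have c': "c \<in> Pow (I \<union> (Out - X))"
    using c by blast
  \<comment> \<open>A true substituted \<open>B\<close> says that the Skolem value itself is an
    enabled letter over \<open>X\<close>, so uniqueness identifies it with
    \<open>\<tau>\<close>.\<close>
  have active: "{x \<in> X. F (s j) (s i) x c} = \<tau>"
    if "j < k" "p j" "bf_subst X (F (s j) (s i)) (B_fun (I \<union> Out) A (s j) (s i)) c" for i j
  proof (rule dependent_letter_unique[OF dep X reach _ _ c])
    show "s j \<in> subset_of_bits k s p"
      using that unfolding subset_of_bits_def by blast
    show "delta A (s j) (c \<union> {x \<in> X. F (s j) (s i) x c}) \<noteq> {}"
      using that(3) unfolding bf_subst_B_fun[OF c X] by blast
  qed (use assms in auto)
  obtain j where j: "j < k" "p j" "q = s j"
    using assms(8) unfolding subset_of_bits_def by blast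
  have letter: "c \<union> \<tau> \<in> Pow (I \<union> Out)"
    using c X \<open>\<tau> \<subseteq> X\<close> by blast
  have "s j \<in> states A"
    using s j(1) by blast
  then have trans: "(s j, q') \<in> transitions (I \<union> Out) A" and "q' \<in> states A"
    using assms(1,10) j letter unfolding nba_over_def transitions_def by blast+
  then obtain i where i: "i < k" "q' = s i"
    using s by blast
  \<comment> \<open>With witness \<open>\<tau>\<close>; the Skolem property then makes the disjunct
    of this transition active.\<close>
  have "ex_quant X (B_fun (I \<union> Out) A (s j) (s i)) c"
    using assms(9,10) i j unfolding ex_quant_B_fun[OF c X] by blast
  then have subst: "bf_subst X (F (s j) (s i)) (B_fun (I \<union> Out) A (s j) (s i)) c"
    using skolem trans i c' unfolding skolem_functions_def by blast
  have "out_bit (dependent_circuit I Out A X k s F) x p c \<longleftrightarrow> x \<in> \<tau>" if "x \<in> X" for x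
    using active active[OF j(1,2) subst] subst trans i j that
    unfolding dependent_circuit_def by auto
  then show ?thesis
    using \<open>\<tau> \<subseteq> X\<close> by blast
qed

theorem theorem4:
  fixes I Out X :: "'v set"
    and A :: "('q, 'v) nba"
    and k :: nat
    and s :: "nat \<Rightarrow> 'q"
    and F :: "'q \<Rightarrow> 'q \<Rightarrow> 'v \<Rightarrow> 'v boolfun"
    and p :: "nat \<Rightarrow> bool"
  assumes "finite I" and "finite Out" and "I \<inter> Out = {}" and "X \<subseteq> Out"
    and "nba_over (I \<union> Out) A"
    and "bij_betw s {..<k} (states A)" and "s 0 = init A"
    and "trim (I \<union> Out) A"
    and "automata_dependent (I \<union> Out) A X (I \<union> (Out - X))"
    and "skolem_functions I Out A X F"
    and "p 0" and "\<forall>j \<in> {1..<k}. \<not> p j"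
  shows "\<forall>w :: ('v set \<times> 'v set) word. (\<forall>n. w n \<in> Pow I \<times> Pow (Out - X)) \<longrightarrow>
    circuit_output (dependent_circuit I Out A X k s F) p (\<lambda>n. fst (w n) \<union> snd (w n)) =
    transducer_output (T\<^sub>X A X) w"
proof (intro allI impI ext)
  fix w :: "('v set \<times> 'v set) word" and n
  assume w: "\<forall>n. w n \<in> Pow I \<times> Pow (Out - X)"
  let ?Z = "I \<union> Out" and ?C = "dependent_circuit I Out A X k s F"
  let ?c = "\<lambda>n. fst (w n) \<union> snd (w n)"
  let ?p = "circuit_state ?C p ?c" and ?U = "transducer_state (T\<^sub>X A X) w"
  have X: "X \<subseteq> ?Z" and c: "?c n \<subseteq> ?Z - X" for n
    using w[rule_format, of n] assms(3,4) by (auto simp: mem_Times_iff)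
  have "I \<union> (Out - X) = ?Z - X"
    using assms(3,4) by blast
  with assms(9) have dep: "automata_dependent ?Z A X (?Z - X)"
    by simp
  have s: "s ` {..<k} = states A"
    using assms(6) by (simp add: bij_betw_def)
  have "init A \<in> states A"
    using assms(5) by (simp add: nba_over_def)
  then have "0 < k"
    using s by (cases k) auto
  \<comment> \<open>Circuit and transducer run in lockstep under the abstraction map.\<close>
  have U: "?U n = subset_of_bits k s (?p n)" for n
  proof (induction n)
    case 0
    show ?case
      using subset_of_bits_initial[OF \<open>0 < k\<close> assms(11,12), of s] assms(7) by (simp add: T\<^sub>X_def)
  next
    case (Suc n)
    then show ?case
      using subset_of_bits_next[OF assms(5) s assms(4) c[of n]] by (simp add: T\<^sub>X_def)
  qed
  have reach: "jointly_reachable ?Z A (?U n)" for n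
  proof (induction n)
    case 0
    show ?case
      using \<open>init A \<in> states A\<close> unfolding jointly_reachable_def
      by (auto simp: T\<^sub>X_def intro: bexI[of _ "[]"])
  next
    case (Suc n)
    then show ?case
      using jointly_reachable_delta_X[OF assms(5) dep X Suc c[of n]] by (simp add: T\<^sub>X_def)
  qed
  have num: "num_bits ?C = k" and outs: "outputs ?C = X"
    by (simp_all add: dependent_circuit_def)
  \<comment> \<open>Both sides produce \<open>None\<close> in exactly the same situations.\<close>
  have bits: "(\<exists>i < k. next_bit ?C i (?p n) (?c n)) \<longleftrightarrow>
      delta_X A X (?U n) (fst (w n), snd (w n)) \<noteq> {}"
    unfolding U subset_of_bits_next[OF assms(5) s assms(4) c[of n], of F, symmetric]
    by (auto simp: subset_of_bits_def)
  have out: "transducer_output (T\<^sub>X A X) w n = lambda_X A X (?U n) (fst (w n), snd (w n))"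
    by (simp add: transducer_output_def T\<^sub>X_def)
  show "circuit_output ?C p ?c n = transducer_output (T\<^sub>X A X) w n"
  proof (cases "delta_X A X (?U n) (fst (w n), snd (w n)) = {}")
    case True
    then have "lambda_X A X (?U n) (fst (w n), snd (w n)) = None"
      unfolding lambda_X_def case_prod_conv by (simp only: simp_thms if_False)
    then show ?thesis
      using True bits unfolding circuit_output_def out num by simp
  next
    case False
    \<comment> \<open>Any enabled transition will do: its part over \<open>X\<close> is shown to be
      the output of both machines.\<close>
    then obtain q \<tau> q' where q: "q \<in> ?U n" "\<tau> \<subseteq> X" "q' \<in> delta A q (?c n \<union> \<tau>)"
      unfolding delta_X_def by auto
    have "{x \<in> X. out_bit ?C x (?p n) (?c n)} = \<tau>"
      using dependent_circuit_output_letter[OF assms(5) s assms(4) c[of n] dep assms(10)]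
        reach[of n] q unfolding U by blast
    moreover have "lambda_X A X (?U n) (fst (w n), snd (w n)) = Some \<tau>"
      using lambda_X_eq[OF dep X reach[of n] q(1) c[of n] q(2,3)] .
    ultimately show ?thesis
      using False bits unfolding circuit_output_def out num outs by simp
  qed
qed

end
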